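(* Under the truncated-spectrum setting of the context with truncation index $r\ge1$ and $\lambda_r>0$, let $f\in\mathcal H_{K_\ell}$ satisfy $f=\Pi_rf$. Then $$\|f\|_{\mathcal H_{K_\ell}}^2\;\le\;\frac1{\lambda_r}\|f\|_{L_2(\mu;\mathbb R^C)}^2\;\le\;\frac C{\lambda_r}\|f\|_\infty^2,$$ where $\|f\|_\infty:=\sup_{Z\in\mathcal Z}\|f(Z)\|_\infty$. In particular, for the loss mapping $\ell_{h,g_D}$ (which satisfies $\ell_{h,g_D}=\Pi_r\ell_{h,g_D}$), $$\|\ell_{h,g_D}\|_{\mathcal H_{K_\ell}}^2\le\frac C{\lambda_r}\|\ell_{h,g_D}\|_\infty^2.$$
   Context: $\mu$ is a probability measure on a space $\mathcal Z$, and $K_\ell:\mathcal Z\times\mathcal Z\to\mathcal L(\mathbb R^C)$ is an operator-valued reproducing kernel inducing the vector-valued RKHS $\mathcal H_{K_\ell}$ of functions $\mathcal Z\to\mathbb R^C$. The integral operator $(T_{K_\ell}u)(Z)=\int_{\mathcal Z}K_\ell(Z,Z')u(Z')\,d\mu(Z')$ on $L_2(\mu;\mathbb R^C)$ is assumed positive, self-adjoint and compact, with eigenvalues $\lambda_1\ge\lambda_2\ge\cdots$ and eigenfunctions $\{\psi_i\}$ orthonormal in $L_2(\mu;\mathbb R^C)$. $\Pi_r$ is the orthogonal projection of $L_2(\mu;\mathbb R^C)$ onto $\mathrm{span}\{\psi_1,\dots,\psi_r\}$. On the truncated space $\mathrm{span}\{\psi_1,\dots,\psi_r\}$ the RKHS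 inner product is $\langle\sum_ia_i\psi_i,\sum_ib_i\psi_i\rangle_{\mathcal H_{K_\ell}}=\sum_{i=1}^ra_ib_i/\lambda_i$. For functions $h,g_D:\mathcal Z\to\mathbb R^C$, $\ell_{h,g_D}(Z)=|h(Z)-g_D(Z)|$ entrywise, and it is assumed that $\ell_{h,g_D}\in\mathcal H_{K_\ell}$ with $\ell_{h,g_D}=\Pi_r\ell_{h,g_D}$. *)

theory Defs
  imports "HOL-Probability.Probability" "HOL-Library.Extended_Nat"
begin

text \<open>The space L2(mu; R^C). Its elements are represented by square-integrable functions; identities
  between classes are stated almost everywhere.\<close>

definition l2_space :: "'z measure \<Rightarrow> ('z \<Rightarrow> real ^ 'c) set" where
  "l2_space M = {u \<in> borel_measurable M. integrable M (\<lambda>z. (norm (u z))\<^sup>2)}"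

definition l2_inner :: "'z measure \<Rightarrow> ('z \<Rightarrow> real ^ 'c) \<Rightarrow> ('z \<Rightarrow> real ^ 'c) \<Rightarrow> real" where
  "l2_inner M u v = (\<integral>z. u z \<bullet> v z \<partial>M)"

definition l2_norm :: "'z measure \<Rightarrow> ('z \<Rightarrow> real ^ 'c) \<Rightarrow> real" where
  "l2_norm M u = sqrt (l2_inner M u u)"

text \<open>The supremum norm takes values in the extended reals, so that unbounded functions have
  norm infinity; the norm on R^C is the maximum norm.\<close>

definition sup_norm :: "('z \<Rightarrow> real ^ 'c) \<Rightarrow> ennreal" where
  "sup_norm u = (SUP z. ennreal (infnorm (u z)))"

definition op_kernel :: "('z \<Rightarrow> 'z \<Rightarrow> (real ^ 'c) \<Rightarrow>\<^sub>L (real ^ 'c)) \<Rightarrow> bool" where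
  "op_kernel K \<longleftrightarrow>
     (\<forall>z w. blinfun_apply (K z w) = adjoint (blinfun_apply (K w z))) \<and>
     (\<forall>(n::nat) z c. 0 \<le> (\<Sum>i<n. \<Sum>j<n. c i \<bullet> blinfun_apply (K (z i) (z j)) (c j)))"

text \<open>\<open>H\<close> with inner product \<open>ip\<close> is the vector-valued RKHS of \<open>K\<close>: a Hilbert space of functions that
  contains the sections of \<open>K\<close> and has the reproducing property (these conditions determine
  \<open>H\<close>, and \<open>ip\<close> on \<open>H\<close>, uniquely).\<close>

definition vv_rkhs ::
  "('z \<Rightarrow> 'z \<Rightarrow> (real ^ 'c) \<Rightarrow>\<^sub>L (real ^ 'c)) \<Rightarrow> ('z \<Rightarrow> real ^ 'c) set
    \<Rightarrow> (('z \<Rightarrow> real ^ 'c) \<Rightarrow> ('z \<Rightarrow> real ^ 'c) \<Rightarrow> real) \<Rightarrow> bool" where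
  "vv_rkhs K H ip \<longleftrightarrow>
     (\<lambda>z. 0) \<in> H \<and>
     (\<forall>f\<in>H. \<forall>g\<in>H. (\<lambda>z. f z + g z) \<in> H) \<and>
     (\<forall>a. \<forall>f\<in>H. (\<lambda>z. a *\<^sub>R f z) \<in> H) \<and>
     (\<forall>f\<in>H. \<forall>g\<in>H. ip f g = ip g f) \<and>
     (\<forall>f\<in>H. \<forall>g\<in>H. \<forall>h\<in>H. ip (\<lambda>z. f z + g z) h = ip f h + ip g h) \<and>
     (\<forall>a. \<forall>f\<in>H. \<forall>g\<in>H. ip (\<lambda>z. a *\<^sub>R f z) g = a * ip f g) \<and>
     (\<forall>f\<in>H. 0 \<le> ip f f) \<and>
     (\<forall>f\<in>H. ip f f = 0 \<longrightarrow> f = (\<lambda>z. 0)) \<and>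
     (\<forall>F. (\<forall>n::nat. F n \<in> H) \<and>
          (\<forall>e>0. \<exists>N. \<forall>m\<ge>N. \<forall>n\<ge>N. ip (\<lambda>z. F m z - F n z) (\<lambda>z. F m z - F n z) < e) \<longrightarrow>
          (\<exists>f\<in>H. (\<lambda>n. ip (\<lambda>z. F n z - f z) (\<lambda>z. F n z - f z)) \<longlonglongrightarrow> 0)) \<and>
     (\<forall>z c. (\<lambda>w. blinfun_apply (K w z) c) \<in> H) \<and>
     (\<forall>f\<in>H. \<forall>z c. f z \<bullet> c = ip f (\<lambda>w. blinfun_apply (K w z) c))"

definition ip_norm ::
  "(('z \<Rightarrow> real ^ 'c) \<Rightarrow> ('z \<Rightarrow> real ^ 'c) \<Rightarrow> real) \<Rightarrow> ('z \<Rightarrow> real ^ 'c) \<Rightarrow> real" where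
  "ip_norm ip f = sqrt (ip f f)"

definition kernel_op ::
  "'z measure \<Rightarrow> ('z \<Rightarrow> 'z \<Rightarrow> (real ^ 'c) \<Rightarrow>\<^sub>L (real ^ 'c))
    \<Rightarrow> ('z \<Rightarrow> real ^ 'c) \<Rightarrow> ('z \<Rightarrow> real ^ 'c)" where
  "kernel_op M K u = (\<lambda>z. \<integral>w. blinfun_apply (K z w) (u w) \<partial>M)"

text \<open>The integral is a total function in the library; convergence for almost every point makes
  the integral operator a genuine linear operator on L2.\<close>

definition kernel_op_welldef ::
  "'z measure \<Rightarrow> ('z \<Rightarrow> 'z \<Rightarrow> (real ^ 'c) \<Rightarrow>\<^sub>L (real ^ 'c)) \<Rightarrow> bool" where
  "kernel_op_welldef M K \<longleftrightarrow>
     (\<forall>u\<in>l2_space M. (AE z in M. integrable M (\<lambda>w. blinfun_apply (K z w) (u w))) \<and>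
                     kernel_op M K u \<in> l2_space M)"

definition l2_positive :: "'z measure \<Rightarrow> (('z \<Rightarrow> real ^ 'c) \<Rightarrow> ('z \<Rightarrow> real ^ 'c)) \<Rightarrow> bool" where
  "l2_positive M T \<longleftrightarrow> (\<forall>u\<in>l2_space M. 0 \<le> l2_inner M (T u) u)"

definition l2_selfadjoint :: "'z measure \<Rightarrow> (('z \<Rightarrow> real ^ 'c) \<Rightarrow> ('z \<Rightarrow> real ^ 'c)) \<Rightarrow> bool" where
  "l2_selfadjoint M T \<longleftrightarrow>
     (\<forall>u\<in>l2_space M. \<forall>v\<in>l2_space M. l2_inner M (T u) v = l2_inner M u (T v))"

definition l2_compact :: "'z measure \<Rightarrow> (('z \<Rightarrow> real ^ 'c) \<Rightarrow> ('z \<Rightarrow> real ^ 'c)) \<Rightarrow> bool" where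
  "l2_compact M T \<longleftrightarrow>
     (\<forall>u. (\<forall>n::nat. u n \<in> l2_space M) \<and> (\<exists>B. \<forall>n. l2_norm M (u n) \<le> B) \<longrightarrow>
          (\<exists>s v. strict_mono (s :: nat \<Rightarrow> nat) \<and> v \<in> l2_space M \<and>
                 (\<lambda>n. l2_norm M (\<lambda>z. T (u (s n)) z - v z)) \<longlonglongrightarrow> 0))"

text \<open>\<open>l_1 \<ge> l_2 \<ge> \<dots>\<close> are the eigenvalues of \<open>T\<close>, listed with multiplicity, with orthonormal
  eigenfunctions \<open>psi_1, psi_2, \<dots>\<close>. There are \<open>N\<close> of them, possibly \<open>N = \<infinity>\<close> (L2 may be
  finite-dimensional). The last clause says that the list is exhaustive: on the orthogonal
  complement of the eigenfunctions listed, \<open>T\<close> vanishes.\<close>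

definition eigen_system ::
  "'z measure \<Rightarrow> (('z \<Rightarrow> real ^ 'c) \<Rightarrow> ('z \<Rightarrow> real ^ 'c)) \<Rightarrow> enat
    \<Rightarrow> (nat \<Rightarrow> real) \<Rightarrow> (nat \<Rightarrow> 'z \<Rightarrow> real ^ 'c) \<Rightarrow> bool" where
  "eigen_system M T N l psi \<longleftrightarrow>
     (let I = {i. 1 \<le> i \<and> enat i \<le> N} in
       (\<forall>i\<in>I. psi i \<in> l2_space M \<and> (AE z in M. T (psi i) z = l i *\<^sub>R psi i z)) \<and>
       (\<forall>i\<in>I. \<forall>j\<in>I. l2_inner M (psi i) (psi j) = (if i = j then 1 else 0)) \<and>
       (\<forall>i\<in>I. \<forall>j\<in>I. i \<le> j \<longrightarrow> l j \<le> l i) \<and>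
       (\<forall>u\<in>l2_space M. (\<forall>i\<in>I. l2_inner M u (psi i) = 0) \<longrightarrow> (AE z in M. T u z = 0)))"

definition lincomb :: "nat \<Rightarrow> (nat \<Rightarrow> 'z \<Rightarrow> real ^ 'c) \<Rightarrow> (nat \<Rightarrow> real) \<Rightarrow> ('z \<Rightarrow> real ^ 'c)" where
  "lincomb r psi a = (\<lambda>z. \<Sum>i=1..r. a i *\<^sub>R psi i z)"

definition trunc_space :: "nat \<Rightarrow> (nat \<Rightarrow> 'z \<Rightarrow> real ^ 'c) \<Rightarrow> ('z \<Rightarrow> real ^ 'c) set" where
  "trunc_space r psi = range (lincomb r psi)"

text \<open>For orthonormal \<open>psi_1, \<dots>, psi_r\<close> the orthogonal projection of \<open>u\<close> in L2 onto
  \<open>trunc_space r psi\<close> is unique as a function, since coefficients are determined by the L2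
  class; no further choice of representative is involved.\<close>

definition l2_proj :: "'z measure \<Rightarrow> ('z \<Rightarrow> real ^ 'c) set \<Rightarrow> ('z \<Rightarrow> real ^ 'c) \<Rightarrow> ('z \<Rightarrow> real ^ 'c)" where
  "l2_proj M S u = (THE v. v \<in> S \<and> (\<forall>w\<in>S. l2_inner M (\<lambda>z. u z - v z) w = 0))"

text \<open>The truncated space lies in the RKHS (each \<open>psi_i\<close>, \<open>i \<le> r\<close>, is the representative of its
  class that belongs to \<open>H\<close>), and the RKHS inner product is diagonal there.\<close>

definition truncated_rkhs ::
  "nat \<Rightarrow> (nat \<Rightarrow> real) \<Rightarrow> (nat \<Rightarrow> 'z \<Rightarrow> real ^ 'c) \<Rightarrow> ('z \<Rightarrow> real ^ 'c) set
    \<Rightarrow> (('z \<Rightarrow> real ^ 'c) \<Rightarrow> ('z \<Rightarrow> real ^ 'c) \<Rightarrow> real) \<Rightarrow> bool" where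
  "truncated_rkhs r l psi H ip \<longleftrightarrow>
     trunc_space r psi \<subseteq> H \<and>
     (\<forall>a b. ip (lincomb r psi a) (lincomb r psi b) = (\<Sum>i=1..r. a i * b i / l i))"

definition loss_map :: "('z \<Rightarrow> real ^ 'c) \<Rightarrow> ('z \<Rightarrow> real ^ 'c) \<Rightarrow> ('z \<Rightarrow> real ^ 'c)" where
  "loss_map h g = (\<lambda>z. \<chi> j. \<bar>h z $ j - g z $ j\<bar>)"

end

theory Submission
  imports Defs
begin

text \<open>Both norms are read off in the eigenbasis. If \<open>f\<close> is its own projection,
  then \<open>f\<close> is the combination of \<open>psi 1\<close>, ..., \<open>psi r\<close> with
  coefficients \<open>a i = l2_inner M f (psi i)\<close> (\<open>l2_proj_trunc_space\<close>). Its
  squared RKHS norm is then the sum of \<open>(a i)^2 / l i\<close>, while Parseval makes its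
  squared L2 norm the sum of \<open>(a i)^2\<close>. The eigenvalues decrease, so \<open>l i\<close>
  is at least \<open>l r > 0\<close>, and comparing the sums term by term gives the first
  inequality. The second has nothing to do with the kernel: a vector with \<open>CARD('c)\<close>
  entries has squared Euclidean norm at most \<open>CARD('c)\<close> times its squared maximum norm,
  and a probability measure integrates this constant bound to itself
  (\<open>l2_norm_le_sup_norm\<close>).\<close>

lemma integrable_inner_l2:
  fixes u v :: "'z \<Rightarrow> real ^ 'c"
  assumes "u \<in> l2_space M" "v \<in> l2_space M"
  shows "integrable M (\<lambda>z. u z \<bullet> v z)"
proof (rule Bochner_Integration.integrable_bound)
  show "integrable M (\<lambda>z. (norm (u z))\<^sup>2 + (norm (v z))\<^sup>2)"
    using assms by (simp add: l2_space_def)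
  have [measurable]: "u \<in> borel_measurable M" "v \<in> borel_measurable M"
    using assms by (simp_all add: l2_space_def)
  show "(\<lambda>z. u z \<bullet> v z) \<in> borel_measurable M"
    by measurable
  have "\<bar>x \<bullet> y\<bar> \<le> (norm x)\<^sup>2 + (norm y)\<^sup>2" for x y :: "real ^ 'c"
  proof -
    have "\<bar>x \<bullet> y\<bar> \<le> norm x * norm y" by (rule Cauchy_Schwarz_ineq2)
    also have "\<dots> \<le> (norm x)\<^sup>2 + (norm y)\<^sup>2"
      using sum_squares_bound[of "norm x" "norm y"] mult_nonneg_nonneg[OF norm_ge_zero norm_ge_zero, of x y]
      unfolding mult.assoc by linarith
    finally show ?thesis .
  qed
  then show "AE z in M. norm (u z \<bullet> v z) \<le> norm ((norm (u z))\<^sup>2 + (norm (v z))\<^sup>2)"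
    by simp
qed

lemma l2_inner_commute: "l2_inner M u v = l2_inner M v u"
  by (simp add: l2_inner_def inner_commute)

text \<open>The integrand is nonnegative, so the integral is too, even where it takes its default
  value 0; squaring therefore undoes the root.\<close>

lemma l2_norm_power2: "(l2_norm M u)\<^sup>2 = l2_inner M u u"
  unfolding l2_norm_def by (simp add: l2_inner_def)

lemma l2_space_add:
  assumes "u \<in> l2_space M" "v \<in> l2_space M"
  shows "(\<lambda>z. u z + v z) \<in> l2_space M"
proof -
  have "integrable M (\<lambda>z. (norm (u z))\<^sup>2 + 2 * (u z \<bullet> v z) + (norm (v z))\<^sup>2)"
    using assms integrable_inner_l2[OF assms] by (simp add: l2_space_def)
  also have "(\<lambda>z. (norm (u z))\<^sup>2 + 2 * (u z \<bullet> v z) + (norm (v z))\<^sup>2) = (\<lambda>z. (norm (u z + v z))\<^sup>2)"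
    by (simp add: power2_norm_eq_inner inner_add inner_commute algebra_simps)
  finally show ?thesis
    using assms by (auto simp: l2_space_def intro: borel_measurable_add)
qed

lemma l2_space_scaleR:
  assumes "u \<in> l2_space M"
  shows "(\<lambda>z. c *\<^sub>R u z) \<in> l2_space M"
  using assms by (auto simp: l2_space_def power_mult_distrib intro: borel_measurable_scaleR)

lemma l2_space_sum:
  assumes "\<And>i. i \<in> A \<Longrightarrow> u i \<in> l2_space M"
  shows "(\<lambda>z. \<Sum>i\<in>A. u i z) \<in> l2_space M"
  using assms
proof (induction A rule: infinite_finite_induct)
  case (insert i A)
  then show ?case using l2_space_add[of "u i" M "\<lambda>z. \<Sum>i\<in>A. u i z"] by simp
\<comment> \<open>For empty or infinite \<open>A\<close> the sum is the zero function.\<close>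
qed (simp_all add: l2_space_def)

lemma lincomb_in_l2:
  assumes "\<forall>i\<in>{1..r}. psi i \<in> l2_space M"
  shows "lincomb r psi a \<in> l2_space M"
  unfolding lincomb_def by (intro l2_space_sum l2_space_scaleR) (use assms in blast)

lemma l2_inner_diff_left:
  assumes "u \<in> l2_space M" "v \<in> l2_space M" "w \<in> l2_space M"
  shows "l2_inner M (\<lambda>z. u z - v z) w = l2_inner M u w - l2_inner M v w"
  using assms unfolding l2_inner_def by (simp add: inner_diff_left integrable_inner_l2)

lemma l2_inner_lincomb_right:
  assumes "u \<in> l2_space M" "\<forall>i\<in>{1..r}. psi i \<in> l2_space M"
  shows "l2_inner M u (lincomb r psi a) = (\<Sum>i=1..r. a i * l2_inner M u (psi i))"
  using assms unfolding l2_inner_def lincomb_def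
  by (simp add: inner_sum_right integrable_inner_l2)

lemma l2_inner_basis_lincomb:
  assumes mem: "\<forall>i\<in>{1..r}. psi i \<in> l2_space M"
    and orth: "\<forall>i\<in>{1..r}. \<forall>j\<in>{1..r}.
                 l2_inner M (psi i) (psi j) = (if i = j then 1 else 0)"
    and j: "j \<in> {1..r}"
  shows "l2_inner M (lincomb r psi a) (psi j) = a j"
proof -
  have "l2_inner M (lincomb r psi a) (psi j) = (\<Sum>i=1..r. a i * l2_inner M (psi j) (psi i))"
    unfolding l2_inner_commute[of M _ "psi j"]
    by (rule l2_inner_lincomb_right) (use mem j in auto)
  also have "\<dots> = (\<Sum>i=1..r. if i = j then a i else 0)"
    by (intro sum.cong) (use orth j in auto)
  finally show ?thesis using j by simp
qed

text \<open>Turns the definite description into Fourier coefficients. The equality holds pointwise,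
  not just almost everywhere, since members of \<open>trunc_space r psi\<close> are fixed by their
  coefficients.\<close>

lemma l2_proj_trunc_space:
  assumes u: "u \<in> l2_space M"
    and mem: "\<forall>i\<in>{1..r}. psi i \<in> l2_space M"
    and orth: "\<forall>i\<in>{1..r}. \<forall>j\<in>{1..r}.
                 l2_inner M (psi i) (psi j) = (if i = j then 1 else 0)"
  shows "l2_proj M (trunc_space r psi) u = lincomb r psi (\<lambda>i. l2_inner M u (psi i))"
  unfolding l2_proj_def
proof (rule the_equality)
  \<comment> \<open>One formula serves both existence (each bracket vanishes for the Fourier
    coefficients) and uniqueness (through a suitable \<open>b\<close>).\<close>
  have residual: "l2_inner M (\<lambda>z. u z - lincomb r psi a z) (lincomb r psi b) =
      (\<Sum>i=1..r. b i * (l2_inner M u (psi i) - a i))" for a b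
  proof -
    have L: "lincomb r psi c \<in> l2_space M" for c
      by (rule lincomb_in_l2) (rule mem)
    have "l2_inner M (\<lambda>z. u z - lincomb r psi a z) (lincomb r psi b) =
        (\<Sum>i=1..r. b i * l2_inner M u (psi i)) -
        (\<Sum>i=1..r. b i * l2_inner M (lincomb r psi a) (psi i))"
      unfolding l2_inner_diff_left[OF u L L] l2_inner_lincomb_right[OF u mem]
        l2_inner_lincomb_right[OF L mem] by (rule refl)
    also have "(\<Sum>i=1..r. b i * l2_inner M (lincomb r psi a) (psi i)) = (\<Sum>i=1..r. b i * a i)"
      by (intro sum.cong refl) (simp only: l2_inner_basis_lincomb[OF mem orth])
    finally show ?thesis
      by (simp add: right_diff_distrib sum_subtractf)
  qed
  then show "lincomb r psi (\<lambda>i. l2_inner M u (psi i)) \<in> trunc_space r psi \<and>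
      (\<forall>w\<in>trunc_space r psi.
         l2_inner M (\<lambda>z. u z - lincomb r psi (\<lambda>i. l2_inner M u (psi i)) z) w = 0)"
    by (auto simp: trunc_space_def)
  fix v
  assume "v \<in> trunc_space r psi \<and>
    (\<forall>w\<in>trunc_space r psi. l2_inner M (\<lambda>z. u z - v z) w = 0)"
  then obtain a where v: "v = lincomb r psi a"
    and "\<And>b. l2_inner M (\<lambda>z. u z - lincomb r psi a z) (lincomb r psi b) = 0"
    by (auto simp: trunc_space_def)
  \<comment> \<open>Testing against the combination whose coefficients are the residual ones turns
    orthogonality into a vanishing sum of squares.\<close>
  then have "(\<Sum>i=1..r. (l2_inner M u (psi i) - a i) * (l2_inner M u (psi i) - a i)) = 0"
    using residual[of a "\<lambda>i. l2_inner M u (psi i) - a i"] by simp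
  then have "\<forall>i\<in>{1..r}. (l2_inner M u (psi i) - a i) * (l2_inner M u (psi i) - a i) = 0"
    by (subst (asm) sum_nonneg_eq_0_iff) auto
  then have "\<And>i. i \<in> {1..r} \<Longrightarrow> a i = l2_inner M u (psi i)"
    by simp
  then show "v = lincomb r psi (\<lambda>i. l2_inner M u (psi i))"
    unfolding v lincomb_def by (intro ext sum.cong) auto
qed

text \<open>The bound holds at every point and is integrated against total mass 1. Working in
  \<open>ennreal\<close> covers unbounded \<open>f\<close>, where the right-hand side is
  infinite.\<close>

lemma (in prob_space) l2_norm_le_sup_norm:
  fixes f :: "'a \<Rightarrow> real ^ 'c"
  assumes f: "f \<in> l2_space M"
  shows "ennreal ((l2_norm M f)\<^sup>2) \<le> of_nat CARD('c) * (sup_norm f)\<^sup>2"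
proof -
  have pt: "ennreal ((norm (f z))\<^sup>2) \<le> of_nat CARD('c) * (sup_norm f)\<^sup>2" for z
  proof -
    have "norm (f z) \<le> sqrt (real CARD('c)) * infnorm (f z)"
      using norm_le_infnorm[of "f z"] by simp
    then have "(norm (f z))\<^sup>2 \<le> (sqrt (real CARD('c)) * infnorm (f z))\<^sup>2"
      by (rule power_mono) simp
    then have "(norm (f z))\<^sup>2 \<le> real CARD('c) * (infnorm (f z))\<^sup>2"
      by (simp add: power_mult_distrib)
    then have "ennreal ((norm (f z))\<^sup>2) \<le> ennreal (real CARD('c) * (infnorm (f z))\<^sup>2)"
      by (rule ennreal_leI)
    also have "\<dots> = of_nat CARD('c) * (ennreal (infnorm (f z)))\<^sup>2"
      by (simp add: ennreal_mult ennreal_power infnorm_pos_le ennreal_of_nat_eq_real_of_nat)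
    also have "\<dots> \<le> of_nat CARD('c) * (sup_norm f)\<^sup>2"
      unfolding sup_norm_def by (intro mult_left_mono power_mono SUP_upper) auto
    finally show ?thesis .
  qed
  have "(l2_norm M f)\<^sup>2 = (\<integral>z. (norm (f z))\<^sup>2 \<partial>M)"
    unfolding l2_norm_power2 by (simp add: l2_inner_def power2_norm_eq_inner)
  then have "ennreal ((l2_norm M f)\<^sup>2) = (\<integral>\<^sup>+z. ennreal ((norm (f z))\<^sup>2) \<partial>M)"
    using f by (subst nn_integral_eq_integral) (auto simp: l2_space_def)
  also have "\<dots> \<le> (\<integral>\<^sup>+z. of_nat CARD('c) * (sup_norm f)\<^sup>2 \<partial>M)"
    by (intro nn_integral_mono pt)
  finally show ?thesis by (simp add: emeasure_space_1)
qed

theorem propositionE4: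
  fixes M :: "'z measure"
    and K :: "'z \<Rightarrow> 'z \<Rightarrow> (real ^ 'c) \<Rightarrow>\<^sub>L (real ^ 'c)"
    and H :: "('z \<Rightarrow> real ^ 'c) set"
    and ip :: "('z \<Rightarrow> real ^ 'c) \<Rightarrow> ('z \<Rightarrow> real ^ 'c) \<Rightarrow> real"
    and N :: enat
    and l :: "nat \<Rightarrow> real"
    and psi :: "nat \<Rightarrow> 'z \<Rightarrow> real ^ 'c"
    and r :: nat
  assumes "prob_space M" and "space M = UNIV"
    and "op_kernel K" and "vv_rkhs K H ip"
    and "kernel_op_welldef M K"
    and "l2_positive M (kernel_op M K)"
    and "l2_selfadjoint M (kernel_op M K)"
    and "l2_compact M (kernel_op M K)"
    and "eigen_system M (kernel_op M K) N l psi"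
    and "1 \<le> r" and "enat r \<le> N" and "0 < l r"
    and "truncated_rkhs r l psi H ip"
  shows "(\<forall>f. f \<in> H \<and> f \<in> l2_space M \<and> f = l2_proj M (trunc_space r psi) f \<longrightarrow>
            (ip_norm ip f)\<^sup>2 \<le> 1 / l r * (l2_norm M f)\<^sup>2 \<and>
            ennreal (1 / l r * (l2_norm M f)\<^sup>2) \<le> ennreal (real CARD('c) / l r) * (sup_norm f)\<^sup>2)
       \<and> (\<forall>h g. loss_map h g \<in> H \<and> loss_map h g \<in> l2_space M \<and>
            loss_map h g = l2_proj M (trunc_space r psi) (loss_map h g) \<longrightarrow>
            ennreal ((ip_norm ip (loss_map h g))\<^sup>2)
              \<le> ennreal (real CARD('c) / l r) * (sup_norm (loss_map h g))\<^sup>2)"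
proof -
  have "{1..r} \<subseteq> {i. 1 \<le> i \<and> enat i \<le> N}"
    using \<open>enat r \<le> N\<close> by (auto intro: order_trans[of "enat _" "enat r"])
  then have mem: "\<forall>i\<in>{1..r}. psi i \<in> l2_space M"
    and orth: "\<forall>i\<in>{1..r}. \<forall>j\<in>{1..r}.
                 l2_inner M (psi i) (psi j) = (if i = j then 1 else 0)"
    and mono: "\<And>i. i \<in> {1..r} \<Longrightarrow> l r \<le> l i"
    using \<open>eigen_system M (kernel_op M K) N l psi\<close> \<open>1 \<le> r\<close> \<open>enat r \<le> N\<close>
    unfolding eigen_system_def Let_def by (blast, blast, auto)
  have rkhs: "(ip_norm ip f)\<^sup>2 \<le> 1 / l r * (l2_norm M f)\<^sup>2"
    if "f \<in> l2_space M" "f = l2_proj M (trunc_space r psi) f" for f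
  proof -
    define a where "a = (\<lambda>i. l2_inner M f (psi i))"
    \<comment> \<open>Equality of functions is needed here, because \<open>ip\<close> acts on
      functions rather than on L2 classes.\<close>
    have f: "f = lincomb r psi a"
      using that l2_proj_trunc_space[OF that(1) mem orth] by (simp add: a_def)
    have ip: "ip f f = (\<Sum>i=1..r. a i * a i / l i)"
      using \<open>truncated_rkhs r l psi H ip\<close> unfolding truncated_rkhs_def f by blast
    have nonneg: "0 \<le> a i * a i / l i" and le: "a i * a i / l i \<le> a i * a i / l r"
      if "i \<in> {1..r}" for i
      using mono[OF that] \<open>0 < l r\<close> by (auto intro!: divide_left_mono)
    \<comment> \<open>The diagonal sum is nonnegative, so squaring cancels the root in
      \<open>ip_norm\<close>.\<close>
    have "(ip_norm ip f)\<^sup>2 = ip f f"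
      using sum_nonneg[of "{1..r}", OF nonneg] by (simp add: ip_norm_def ip)
    also have "\<dots> \<le> (\<Sum>i=1..r. a i * a i / l r)"
      unfolding ip by (intro sum_mono le)
    also have "\<dots> = 1 / l r * (\<Sum>i=1..r. a i * l2_inner M f (psi i))"
      by (simp add: a_def sum_divide_distrib)
    \<comment> \<open>Parseval: expand only the second argument of
      \<open>l2_inner M f f\<close>.\<close>
    also have "(\<Sum>i=1..r. a i * l2_inner M f (psi i)) = (l2_norm M f)\<^sup>2"
      using l2_inner_lincomb_right[OF that(1) mem, of a] by (simp add: l2_norm_power2 flip: f)
    finally show ?thesis .
  qed
  have sup: "ennreal (1 / l r * (l2_norm M f)\<^sup>2) \<le> ennreal (real CARD('c) / l r) * (sup_norm f)\<^sup>2"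
    if "f \<in> l2_space M" for f :: "'z \<Rightarrow> real ^ 'c"
  proof -
    have "ennreal (1 / l r * (l2_norm M f)\<^sup>2) = ennreal (1 / l r) * ennreal ((l2_norm M f)\<^sup>2)"
      using \<open>0 < l r\<close> by (intro ennreal_mult) auto
    also have "\<dots> \<le> ennreal (1 / l r) * (ennreal (real CARD('c)) * (sup_norm f)\<^sup>2)"
      using prob_space.l2_norm_le_sup_norm[OF \<open>prob_space M\<close> that]
      by (intro mult_left_mono) (auto simp: ennreal_of_nat_eq_real_of_nat)
    also have "\<dots> = ennreal (real CARD('c) / l r) * (sup_norm f)\<^sup>2"
      using \<open>0 < l r\<close> by (simp add: mult.assoc[symmetric] flip: ennreal_mult)
    finally show ?thesis .
  qed
  \<comment> \<open>The loss mapping is an instance of \<open>f\<close>; its bound chains the two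
    inequalities after moving the first to \<open>ennreal\<close>.\<close>
  show ?thesis
    by (meson rkhs sup ennreal_leI order_trans)
qed

end
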